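(* Let $\mathbb{K}$ be the field of real or complex numbers, let $X$ be a topological vector space over $\mathbb{K}$, and let $Y$ be an abelian group. Let $n\ge 2$, let $U\subseteq X^n$ be a non-empty open connected set, and let $f:U_+\to Y$, $g_1:U_1\to Y,\ldots,g_n:U_n\to Y$ be functions such that $$f\Big(\sum_{i\le n}x_i\Big)=\sum_{i\le n}g_i(x_i)\qquad\text{for all }(x_1,\ldots,x_n)\in U.$$ Then there exists a unique extension $(F,G_1,\ldots,G_n)$ of $(f,g_1,\ldots,g_n)$, with $F,G_1,\ldots,G_n:X\to Y$, for which $$F\Big(\sum_{i\le n}x_i\Big)=\sum_{i\le n}G_i(x_i)\qquad\text{for all }x_1,\ldots,x_n\in X.$$ In fact, there exist a unique group homomorphism $A:X\to Y$ and unique $u,u_1,\ldots,u_n\in Y$ such that $u=\sum_{i\le n}u_i$ and $$F(x)=A(x)+u\quad\text{and}\quad G_i(x)=A(x)+u_i\qquad\text{for all }x\in X\text{ and all } i=1,\ldots,n.$$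
   Context: $X^n$ carries the product topology. For $U\subseteq X^n$ and $i=1,\ldots,n$, $U_i:=\pi_i(U)\subseteq X$ denotes the image of $U$ under the $i$-th coordinate projection $\pi_i$, and $U_+:=\{x_1+\cdots+x_n:(x_1,\ldots,x_n)\in U\}\subseteq X$. That $(F,G_1,\ldots,G_n)$ is an extension of $(f,g_1,\ldots,g_n)$ means that $F$ restricted to $U_+$ equals $f$ and $G_i$ restricted to $U_i$ equals $g_i$ for every $i$. Group homomorphism means homomorphism from the additive group of $X$ to $Y$ (written additively). *)

theory Defs
  imports "HOL-Analysis.Analysis"
begin

text \<open>
  The scalar type ranges over the class \<open>real_normed_field\<close>. It has the instances
  \<open>real\<close> and \<open>complex\<close>, and by the Gelfand-Mazur theorem every instance is isometrically
  isomorphic to one of these two. The additive half of the compatibility between topology and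
  algebra is provided by the class \<open>topological_ab_group_add\<close>. No separation axiom is assumed.
\<close>

locale topological_vector_space = vector_space scale
  for scale :: "'k::real_normed_field \<Rightarrow> 'x::topological_ab_group_add \<Rightarrow> 'x" +
  assumes continuous_scale: "continuous_on UNIV (\<lambda>(c, x). scale c x)"

text \<open>
  A point of $X^n$ is a vector \<open>x :: 'x ^ 'n\<close>, where \<open>'n\<close> is a finite type with
  $n$ elements; the topology on \<open>'x ^ 'n\<close> is the product topology.
\<close>

definition coord_proj :: "('x ^ 'n) set \<Rightarrow> 'n \<Rightarrow> 'x set" where
  "coord_proj U i = (\<lambda>x. x $ i) ` U"

definition coord_sums :: "('x::ab_group_add ^ 'n) set \<Rightarrow> 'x set" where
  "coord_sums U = (\<lambda>x. \<Sum>i\<in>UNIV. x $ i) ` U"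

definition pexider_on ::
  "('x::ab_group_add ^ 'n) set \<Rightarrow> ('x \<Rightarrow> 'y::ab_group_add) \<Rightarrow> ('n \<Rightarrow> 'x \<Rightarrow> 'y) \<Rightarrow> bool" where
  "pexider_on U f g \<longleftrightarrow> (\<forall>x\<in>U. f (\<Sum>i\<in>UNIV. x $ i) = (\<Sum>i\<in>UNIV. g i (x $ i)))"

text \<open>
  The partial functions $f : U_+ \to Y$ and $g_i : U_i \to Y$ are represented by total functions
  whose values outside \<open>coord_sums U\<close> and \<open>coord_proj U i\<close> are irrelevant.
\<close>

definition extends_on ::
  "('x::ab_group_add ^ 'n) set \<Rightarrow> ('x \<Rightarrow> 'y) \<Rightarrow> ('n \<Rightarrow> 'x \<Rightarrow> 'y) \<Rightarrow>
     ('x \<Rightarrow> 'y) \<Rightarrow> ('n \<Rightarrow> 'x \<Rightarrow> 'y) \<Rightarrow> bool" where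
  "extends_on U f g F G \<longleftrightarrow>
     (\<forall>s\<in>coord_sums U. F s = f s) \<and> (\<forall>i. \<forall>t\<in>coord_proj U i. G i t = g i t)"

end

theory Submission
  imports Defs
begin

text \<open>
  Near each point of \<open>U\<close> the increments of \<open>f\<close> and of all the \<open>g i\<close> coincide and
  are additive, so by repeated halving they extend to an additive map \<open>A\<close> on the whole space.
  Hence on a neighbourhood of each point \<open>g i (x $ i) = A (x $ i) + v i\<close>. The pair
  \<open>(A, v)\<close> is determined by the germ of \<open>g\<close> at that point, so it is locally constant,
  and by connectedness constant, on \<open>U\<close>.
\<close>

section \<open>Halving towards 0 and extension of locally additive maps\<close>

lemma funpow_double_add:
  fixes x y :: "'a::ab_semigroup_add"
  shows "((\<lambda>z. z + z) ^^ k) (x + y) = ((\<lambda>z. z + z) ^^ k) x + ((\<lambda>z. z + z) ^^ k) y"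
  by (induction k) (simp_all add: ac_simps)

context topological_vector_space
begin

lemma tendsto_scale:
  assumes "(a \<longlongrightarrow> c) F" "(b \<longlongrightarrow> x) F"
  shows "((\<lambda>t. scale (a t) (b t)) \<longlongrightarrow> scale c x) F"
proof -
  have "((\<lambda>t. (\<lambda>(c, x). scale c x) (a t, b t)) \<longlongrightarrow> (\<lambda>(c, x). scale c x) (c, x)) F"
    by (rule continuous_on_tendsto_compose[OF continuous_scale tendsto_Pair[OF assms]]) auto
  then show ?thesis by simp
qed

text \<open>Halving is used because its inverse, doubling, makes sense in every abelian group,
  whereas \<open>'y\<close> admits no division or scaling.\<close>

abbreviation shrink :: "nat \<Rightarrow> 'x \<Rightarrow> 'x" where
  "shrink k x \<equiv> scale ((1/2) ^ k) x"

lemma shrink_Suc_double: "shrink (Suc k) x + shrink (Suc k) x = shrink k x"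
proof -
  have "(1/2) ^ Suc k + (1/2) ^ Suc k = ((1/2) ^ k :: 'k)" by simp
  then show ?thesis by (metis scale_left_distrib)
qed

lemma eventually_shrink:
  assumes "eventually P (nhds 0)"
  shows "\<forall>\<^sub>F k in sequentially. P (shrink k x)"
proof -
  have "(\<lambda>k. (1/2) ^ k :: 'k) \<longlonglongrightarrow> 0"
    by (rule LIMSEQ_power_zero) (simp add: norm_divide)
  then have "(\<lambda>k. shrink k x) \<longlonglongrightarrow> 0"
    using tendsto_scale[OF _ tendsto_const, of "\<lambda>k. (1/2) ^ k" 0 sequentially x] by simp
  with assms show ?thesis by (simp add: filterlim_iff)
qed

text \<open>The standard fact that each neighbourhood of 0 contains a balanced one. Joint continuity
  at (0, 0) handles small scalars, and a fixed rescaling brings the whole unit ball of scalars into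
  that range.\<close>

lemma eventually_balanced:
  assumes "eventually P (nhds 0)"
  shows "\<forall>\<^sub>F b in nhds 0. \<forall>c. norm c \<le> 1 \<longrightarrow> P (scale c b)"
proof -
  have "((\<lambda>z. scale (fst z) (snd z)) \<longlongrightarrow> scale 0 0) (nhds 0 \<times>\<^sub>F nhds 0)"
    by (intro tendsto_scale filterlim_fst filterlim_snd)
  then have "\<forall>\<^sub>F z in nhds 0 \<times>\<^sub>F nhds 0. P (scale (fst z) (snd z))"
    using assms by (simp add: filterlim_iff)
  then obtain Pc Pv where ev: "eventually Pc (nhds 0)" "eventually Pv (nhds 0)"
    and P: "\<And>c x. Pc c \<Longrightarrow> Pv x \<Longrightarrow> P (scale c x)"
    unfolding eventually_prod_filter by auto
  from ev(1) obtain d where d: "d > 0" "\<And>c. dist c 0 < d \<Longrightarrow> Pc c"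
    unfolding eventually_nhds_metric by auto
  \<comment> \<open>The rescaling factor: \<open>scale c b\<close> equals
    \<open>scale (c * e) (scale (inverse e) b)\<close>, where \<open>c * e\<close> has norm below
    \<open>d\<close>.\<close>
  define e :: 'k where "e = of_real (d / 2)"
  have e: "e \<noteq> 0" "norm e < d" using d(1) by (simp_all add: e_def)
  have "((\<lambda>b. scale (inverse e) b) \<longlongrightarrow> scale (inverse e) 0) (nhds 0)"
    by (intro tendsto_scale tendsto_const filterlim_ident)
  then have "\<forall>\<^sub>F b in nhds 0. Pv (scale (inverse e) b)"
    using ev(2) by (simp add: filterlim_iff)
  then show ?thesis
  proof (eventually_elim, intro allI impI)
    fix b :: 'x and c :: 'k
    assume b: "Pv (scale (inverse e) b)" and c: "norm c \<le> 1"
    have "norm (c * e) \<le> norm e"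
      using c by (simp add: norm_mult mult_left_le_one_le)
    then have "Pc (c * e)" using d(2) e(2) by (simp add: dist_norm)
    from P[OF this b] show "P (scale c b)" using e(1) by (simp add: mult.assoc)
  qed
qed

text \<open>Recovers \<open>A x\<close> from a value of \<open>A\<close> arbitrarily close to 0;
  hence additive maps are determined by their germs at 0.\<close>

lemma additive_shrink:
  assumes "Modules.additive A"
  shows "((\<lambda>z. z + z) ^^ k) (A (shrink k x)) = A x"
proof (induction k)
  case (Suc k)
  have "A (shrink (Suc k) x) + A (shrink (Suc k) x) = A (shrink k x)"
    using assms shrink_Suc_double by (metis Modules.additive.add)
  then show ?case using Suc by (simp add: funpow_Suc_right del: funpow.simps power_Suc)
qed simp

lemma additive_eqI:
  fixes A B :: "'x \<Rightarrow> 'y::ab_group_add"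
  assumes "Modules.additive A" "Modules.additive B" "\<forall>\<^sub>F w in nhds 0. A w = B w"
  shows "A = B"
proof
  fix x
  obtain k where "A (shrink k x) = B (shrink k x)"
    using eventually_shrink[OF assms(3)] eventually_happens sequentially_bot by blast
  then show "A x = B x" 
    using assms(1,2)[THEN additive_shrink, of k x] by simp
qed

text \<open>Halving an argument until it lies in \<open>W\<close>, applying \<open>h\<close> and
  doubling back gives a value independent of the number of halvings, once this number is large
  enough.\<close>

lemma additive_extension:
  fixes h :: "'x \<Rightarrow> 'y::ab_group_add"
  assumes W: "\<forall>\<^sub>F w in nhds 0. w \<in> W"
    and h: "\<And>a b. a \<in> W \<Longrightarrow> b \<in> W \<Longrightarrow> h (a + b) = h a + h b"
  obtains A where "Modules.additive A" "\<forall>\<^sub>F w in nhds 0. A w = h w"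
proof -
  define s where "s = (\<lambda>x k. ((\<lambda>z. z + z) ^^ k) (h (shrink k x)))"
  \<comment> \<open>Additivity of \<open>h\<close> with both summands equal to
    \<open>shrink (Suc k) x\<close>.\<close>
  have s_Suc: "s x (Suc k) = s x k" if "shrink (Suc k) x \<in> W" for x k
    using h[OF that that] unfolding shrink_Suc_double s_def
    by (simp add: funpow_Suc_right del: funpow.simps power_Suc)
  have const: "s x k = s x N" if "\<And>k. k \<ge> N \<Longrightarrow> shrink k x \<in> W" "k \<ge> N" for x k N
    using that(2)
  proof (induction k rule: dec_induct)
    case (step k)
    then show ?case using s_Suc[OF that(1)[of "Suc k"]] by simp
  qed simp
  \<comment> \<open>With no topology on \<open>'y\<close>, the limit of \<open>s x\<close> is taken
    to be its eventually constant value.\<close>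
  define A where "A = (\<lambda>x. THE y. \<forall>\<^sub>F k in sequentially. s x k = y)"
  have A_eq: "A x = y" if "\<forall>\<^sub>F k in sequentially. s x k = y" for x y
    unfolding A_def
  proof (rule the_equality[where P = "\<lambda>y. \<forall>\<^sub>F k in sequentially. s x k = y", OF that])
    fix z assume "\<forall>\<^sub>F k in sequentially. s x k = z"
    with that have "\<forall>\<^sub>F k in sequentially. z = y" by eventually_elim simp
    then show "z = y" by simp
  qed
  have A: "\<forall>\<^sub>F k in sequentially. s x k = A x" for x
  proof -
    obtain N where "\<And>k. k \<ge> N \<Longrightarrow> shrink k x \<in> W"
      using eventually_shrink[OF W, of x] unfolding eventually_sequentially by auto
    then have "\<forall>\<^sub>F k in sequentially. s x k = s x N"
      unfolding eventually_sequentially using const by blast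
    then show ?thesis using A_eq by metis
  qed
  have "Modules.additive A"
  proof
    fix x y
    have "\<forall>\<^sub>F k in sequentially. s (x + y) k = A x + A y"
      using A[of x] A[of y] eventually_shrink[OF W, of x] eventually_shrink[OF W, of y]
    proof eventually_elim
      case (elim k)
      have "s (x + y) k = s x k + s y k"
        using h[OF elim(3,4)] by (simp only: s_def scale_right_distrib funpow_double_add)
      with elim(1,2) show ?case by simp
    qed
    then show "A (x + y) = A x + A y" by (rule A_eq)
  qed
  \<comment> \<open>On a balanced core of \<open>W\<close> all halvings of \<open>w\<close> stay in
    \<open>W\<close>, so \<open>s w\<close> is constant from index 0 on, where it equals
    \<open>h w\<close>.\<close>
  moreover have "\<forall>\<^sub>F w in nhds 0. A w = h w"
    using eventually_balanced[OF W]
  proof eventually_elim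
    case (elim w)
    have "shrink k w \<in> W" for k
      using elim by (simp add: norm_power norm_divide power_le_one)
    then have "s w k = s w 0" for k
      by (intro const) auto
    then show ?case by (intro A_eq) (simp add: s_def)
  qed
  ultimately show thesis by (rule that)
qed

end

section \<open>Increments and global solutions of the Pexider equation\<close>

text \<open>
  Moving one coordinate of \<open>p\<close> identifies each increment of \<open>g i\<close> with one of \<open>f\<close>;
  moving two of them gives additivity.
\<close>

lemma pexider_increments:
  fixes U :: "('x::ab_group_add ^ 'n) set" and f :: "'x \<Rightarrow> 'y::ab_group_add"
  assumes card: "CARD('n) \<ge> 2" and pex: "pexider_on U f g"
    and W: "0 \<in> W" "{x. \<forall>i. x $ i - p $ i \<in> W} \<subseteq> U"
  defines "h \<equiv> \<lambda>w. f ((\<Sum>i\<in>UNIV. p $ i) + w) - f (\<Sum>i\<in>UNIV. p $ i)"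
  shows "\<And>i w. w \<in> W \<Longrightarrow> g i (p $ i + w) = g i (p $ i) + h w"
    and "\<And>a b. a \<in> W \<Longrightarrow> b \<in> W \<Longrightarrow> h (a + b) = h a + h b"
proof -
  \<comment> \<open>The difference of the equations at \<open>p + w\<close> and at
    \<open>p\<close>.\<close>
  have shift: "h (\<Sum>i\<in>UNIV. w i) = (\<Sum>i\<in>UNIV. g i (p $ i + w i) - g i (p $ i))"
    if "\<And>i. w i \<in> W" for w
  proof -
    have "(\<chi> i. p $ i + w i) \<in> U" "p \<in> U"
      using that W by auto
    from this[THEN pex[unfolded pexider_on_def, rule_format]] show ?thesis
      by (simp add: h_def sum.distrib sum_subtractf)
  qed
  show one: "g i (p $ i + w) = g i (p $ i) + h w" if "w \<in> W" for i w
  proof -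
    have "h w = (\<Sum>j\<in>UNIV. g j (p $ j + (if j = i then w else 0)) - g j (p $ j))"
      using shift[of "\<lambda>j. if j = i then w else 0"] that W(1) by simp
    also have "\<dots> = (\<Sum>j\<in>UNIV. if j = i then g i (p $ i + w) - g i (p $ i) else 0)"
      by (intro sum.cong) auto
    finally show ?thesis by simp
  qed
  show "h (a + b) = h a + h b" if "a \<in> W" "b \<in> W" for a b
  proof -
    \<comment> \<open>Here n >= 2 enters: \<open>a\<close> and \<open>b\<close> are moved in
      different coordinates, so that \<open>W\<close> need not contain \<open>a + b\<close>.\<close>
    obtain i j :: 'n where ij: "i \<noteq> j"
      using card by (metis card_2_iff' card_le_Suc0_iff_eq finite not_less_eq_eq numeral_2_eq_2 UNIV_I)
    define w where "w = (\<lambda>k. (if k = i then a else 0) + (if k = j then b else 0))"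
    have w: "w k \<in> W" for k using that W(1) ij by (simp add: w_def)
    have "h 0 = 0" by (simp add: h_def)
    then have "h (w k) = (if k = i then h a else 0) + (if k = j then h b else 0)" for k
      using ij by (simp add: w_def)
    then have "h (\<Sum>k\<in>UNIV. w k) = h a + h b"
      using shift[OF w] one[OF w] by (simp add: sum.distrib)
    moreover have "(\<Sum>k\<in>UNIV. w k) = a + b" by (simp add: w_def sum.distrib)
    ultimately show ?thesis by simp
  qed
qed

lemma pexider_on_additive:
  assumes "Modules.additive A" "\<And>x. F x = A x + (\<Sum>i\<in>UNIV. v i)" "\<And>i x. G i x = A x + v i"
  shows "pexider_on U F G"
  by (simp add: pexider_on_def assms Modules.additive.sum sum.distrib)

text \<open>The increment lemma with base point 0 and \<open>W = UNIV\<close>: the increment of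
  \<open>F\<close> from 0 is itself the additive map.\<close>

lemma pexider_on_UNIV:
  fixes F :: "'x::ab_group_add \<Rightarrow> 'y::ab_group_add" and G :: "'n::finite \<Rightarrow> 'x \<Rightarrow> 'y"
  assumes "CARD('n) \<ge> 2" "pexider_on UNIV F G"
  obtains A v where "Modules.additive A" "\<And>x. F x = A x + (\<Sum>i\<in>UNIV. v i)"
    "\<And>i x. G i x = A x + v i"
proof -
  define A where "A w = F w - F 0" for w
  have "Modules.additive A"
  proof
    show "A (a + b) = A a + A b" for a b
      using pexider_increments(2)[OF assms, of UNIV 0 a b] by (simp add: A_def)
  qed
  moreover have "F x = A x + (\<Sum>i\<in>UNIV. G i 0)" for x
    using assms(2)[unfolded pexider_on_def, rule_format, of 0] by (simp add: A_def)
  moreover have "G i x = A x + G i 0" for i x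
    using pexider_increments(1)[OF assms, of UNIV 0 x i] by (simp add: A_def)
  ultimately show thesis using that by blast
qed

section \<open>Affine germs and their constancy on connected sets\<close>

text \<open>Only \<open>g\<close> is recorded, since on \<open>U\<close> the equation recovers
  \<open>f\<close>. Asking for the identity near \<open>p\<close>, not just at \<open>p\<close>,
  makes the condition open in \<open>p\<close>.\<close>

definition affine_germ ::
  "('n \<Rightarrow> 'x::topological_ab_group_add \<Rightarrow> 'y::ab_group_add) \<Rightarrow> 'x ^ 'n \<Rightarrow>
     ('x \<Rightarrow> 'y) \<Rightarrow> ('n \<Rightarrow> 'y) \<Rightarrow> bool" where
  "affine_germ g p A v \<longleftrightarrow>
     Modules.additive A \<and> (\<forall>\<^sub>F x in nhds p. \<forall>i. g i (x $ i) = A (x $ i) + v i)"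

context topological_vector_space
begin

text \<open>Subtracting the two identities at \<open>p\<close> from those at nearby points leaves
  \<open>A = B\<close> near 0, hence everywhere; the constants are then compared at
  \<open>p\<close>.\<close>

lemma affine_germ_unique:
  fixes p :: "'x ^ 'n" and v w :: "'n \<Rightarrow> 'y::ab_group_add"
  assumes "affine_germ g p A v" "affine_germ g p B w"
  shows "A = B \<and> v = w"
proof -
  have ev: "\<forall>\<^sub>F x in nhds p. \<forall>i. A (x $ i) + v i = B (x $ i) + w i"
    using assms[unfolded affine_germ_def, THEN conjunct2] by eventually_elim metis
  then have at_p: "A (p $ i) + v i = B (p $ i) + w i" for i
    by (auto dest: eventually_nhds_x_imp_x)
  have add: "Modules.additive A" "Modules.additive B"
    using assms by (auto simp: affine_germ_def)
  \<comment> \<open>Moving along the diagonal suffices to reach all small increments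
    \<open>t\<close> in a single coordinate.\<close>
  have "((\<lambda>t. \<chi> i. p $ i + t) \<longlongrightarrow> (\<chi> i. p $ i + 0)) (nhds 0)"
    by (intro tendsto_vec_lambda tendsto_add tendsto_const filterlim_ident)
  then have "((\<lambda>t. \<chi> i. p $ i + t) \<longlongrightarrow> p) (nhds 0)" by simp
  with ev have "\<forall>\<^sub>F t in nhds 0. \<forall>i. A (p $ i + t) + v i = B (p $ i + t) + w i"
    by (auto simp: filterlim_iff dest: spec[where x = "\<lambda>x. \<forall>i. A (x $ i) + v i = B (x $ i) + w i"])
  then have "\<forall>\<^sub>F t in nhds 0. A t = B t"
  proof eventually_elim
    case (elim t)
    from elim[rule_format, of undefined] at_p[of undefined] show ?case
      by (simp add: add[THEN Modules.additive.add] algebra_simps)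
  qed
  from additive_eqI[OF add this] show ?thesis using at_p by auto
qed

lemma affine_germ_exists:
  fixes U :: "('x ^ 'n) set" and f :: "'x \<Rightarrow> 'y::ab_group_add"
  assumes "CARD('n) \<ge> 2" "pexider_on U f g" "open U" "p \<in> U"
  shows "\<exists>A v. affine_germ g p A v"
proof -
  obtain S where S: "\<And>i. open (S i)" "\<And>i. p $ i \<in> S i" "\<And>x. (\<And>i. x $ i \<in> S i) \<Longrightarrow> x \<in> U"
    using assms(3,4) unfolding open_vec_def by metis
  \<comment> \<open>One set of increments serving all coordinates: finitely many translated sides of
    an open box around \<open>p\<close> are intersected.\<close>
  define W where "W = {w. \<forall>i. p $ i + w \<in> S i}"
  have "((\<lambda>w. p $ i + w) \<longlongrightarrow> p $ i + 0) (nhds 0)" for i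
    by (intro tendsto_add tendsto_const filterlim_ident)
  then have "\<forall>\<^sub>F w in nhds 0. p $ i + w \<in> S i" for i
    using S(1,2)[of i] by (auto dest: topological_tendstoD)
  then have W: "\<forall>\<^sub>F w in nhds 0. w \<in> W"
    by (simp add: W_def eventually_all_finite)
  have W0: "0 \<in> W" using S(2) by (simp add: W_def)
  have WU: "{x. \<forall>i. x $ i - p $ i \<in> W} \<subseteq> U"
  proof (intro subsetI S(3))
    fix x i assume "x \<in> {x. \<forall>i. x $ i - p $ i \<in> W}"
    then have "p $ i + (x $ i - p $ i) \<in> S i" unfolding W_def by blast
    then show "x $ i \<in> S i" by simp
  qed
  define h where "h = (\<lambda>w. f ((\<Sum>i\<in>UNIV. p $ i) + w) - f (\<Sum>i\<in>UNIV. p $ i))"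
  have inc: "g i (p $ i + w) = g i (p $ i) + h w" if "w \<in> W" for i w
    unfolding h_def using that by (rule pexider_increments(1)[OF assms(1,2) W0 WU])
  have "h (a + b) = h a + h b" if "a \<in> W" "b \<in> W" for a b
    unfolding h_def using that by (rule pexider_increments(2)[OF assms(1,2) W0 WU])
  from W this obtain A where A: "Modules.additive A" "\<forall>\<^sub>F w in nhds 0. A w = h w"
    by (rule additive_extension[where h = h])
  have ev: "\<forall>\<^sub>F w in nhds 0. w \<in> W \<and> A w = h w"
    using W A(2) by (rule eventually_conj)
  have "((\<lambda>x. x $ i - p $ i) \<longlongrightarrow> p $ i - p $ i) (nhds p)" for i
    by (intro tendsto_diff tendsto_vec_nth tendsto_const filterlim_ident)
  then have "\<forall>\<^sub>F x in nhds p. x $ i - p $ i \<in> W \<and> A (x $ i - p $ i) = h (x $ i - p $ i)" for i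
    using ev by (auto simp: filterlim_iff)
  then have "\<forall>\<^sub>F x in nhds p. \<forall>i. x $ i - p $ i \<in> W \<and> A (x $ i - p $ i) = h (x $ i - p $ i)"
    by (rule eventually_all_finite)
  \<comment> \<open>Expanding \<open>A (x $ i - p $ i)\<close> by additivity shows which constant
    \<open>v i\<close> must be.\<close>
  then have "\<forall>\<^sub>F x in nhds p. \<forall>i. g i (x $ i) = A (x $ i) + (g i (p $ i) - A (p $ i))"
  proof (eventually_elim, intro allI)
    fix x i
    assume "\<forall>i. x $ i - p $ i \<in> W \<and> A (x $ i - p $ i) = h (x $ i - p $ i)"
    then have "g i (p $ i + (x $ i - p $ i)) = g i (p $ i) + A (x $ i - p $ i)"
      using inc by metis
    then show "g i (x $ i) = A (x $ i) + (g i (p $ i) - A (p $ i))"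
      by (simp add: Modules.additive.diff[OF A(1)])
  qed
  with A(1) show ?thesis unfolding affine_germ_def
    by (intro exI[of _ A] exI[of _ "\<lambda>i. g i (p $ i) - A (p $ i)"] conjI)
qed

lemma affine_germ_connected:
  fixes U :: "('x ^ 'n) set" and f :: "'x \<Rightarrow> 'y::ab_group_add"
  assumes "CARD('n) \<ge> 2" "pexider_on U f g" "open U" "connected U" "U \<noteq> {}"
  obtains A v where "\<And>p. p \<in> U \<Longrightarrow> affine_germ g p A v"
proof -
  \<comment> \<open>By uniqueness of germs, \<open>D\<close> is a well-defined function on
    \<open>U\<close>; it is shown to be locally constant.\<close>
  define D where "D p = (THE d. affine_germ g p (fst d) (snd d))" for p
  have D_eq: "D p = (A, v)" if "affine_germ g p A v" for p A v
    unfolding D_def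
  proof (rule the_equality)
    show "d = (A, v)" if "affine_germ g p (fst d) (snd d)" for d
      using affine_germ_unique[OF that \<open>affine_germ g p A v\<close>] by (simp add: prod_eq_iff)
  qed (simp add: that)
  have D: "affine_germ g p (fst (D p)) (snd (D p))" if "p \<in> U" for p
  proof -
    obtain A v where "affine_germ g p A v"
      using affine_germ_exists[OF assms(1-3) \<open>p \<in> U\<close>] by blast
    with D_eq[OF this] show ?thesis by simp
  qed
  have "\<forall>\<^sub>F q in at p within U. D p = D q" if "p \<in> U" for p
  proof -
    \<comment> \<open>What holds near \<open>p\<close> also holds near every \<open>q\<close> close
      to \<open>p\<close>, so the germ at \<open>p\<close> serves at \<open>q\<close> too.\<close>
    have "\<forall>\<^sub>F q in nhds p. affine_germ g q (fst (D p)) (snd (D p))"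
      using D[OF that] unfolding affine_germ_def by (simp add: eventually_eventually)
    then have "\<forall>\<^sub>F q in nhds p. D p = D q"
      by eventually_elim (auto dest: D_eq)
    then show ?thesis by (auto simp: eventually_at_filter elim: eventually_mono)
  qed
  then have "D p = D q" if "p \<in> U" "q \<in> U" for p q
    using connected_local_const[OF assms(4) that] by blast
  with D assms(5) show thesis by (metis ex_in_conv that)
qed

end

section \<open>Existence and uniqueness of the global extension\<close>

theorem theorem1p6:
  fixes scale :: "'k::real_normed_field \<Rightarrow> 'x::topological_ab_group_add \<Rightarrow> 'x"
    and U :: "('x ^ 'n) set"
    and f :: "'x \<Rightarrow> 'y::ab_group_add"
    and g :: "'n \<Rightarrow> 'x \<Rightarrow> 'y"
  assumes "topological_vector_space scale"
    and "CARD('n) \<ge> 2"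
    and "U \<noteq> {}" and "open U" and "connected U"
    and "pexider_on U f g"
  shows "(\<exists>!(F, G). extends_on U f g F G \<and> pexider_on UNIV F G) \<and>
    (\<forall>F G. extends_on U f g F G \<and> pexider_on UNIV F G \<longrightarrow>
       (\<exists>!(A, u, v). Modules.additive A \<and> u = (\<Sum>i\<in>UNIV. v i) \<and>
          (\<forall>x. F x = A x + u) \<and> (\<forall>i x. G i x = A x + v i)))"
proof -
  interpret topological_vector_space scale by fact
  obtain A v where germ: "\<And>p. p \<in> U \<Longrightarrow> affine_germ g p A v"
    using affine_germ_connected[OF assms(2,6,4,5,3)] by blast
  obtain p where p: "p \<in> U" using assms(3) by blast
  have add: "Modules.additive A" using germ[OF p] by (simp add: affine_germ_def)
  have g: "g i (x $ i) = A (x $ i) + v i" if "x \<in> U" for x i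
    using germ[OF that] by (auto simp: affine_germ_def dest: eventually_nhds_x_imp_x)
  define F where "F = (\<lambda>x. A x + (\<Sum>i\<in>UNIV. v i))"
  define G where "G = (\<lambda>i x. A x + v i)"
  have FG: "pexider_on V F G" for V
    using add by (rule pexider_on_additive) (simp_all add: F_def G_def)
  \<comment> \<open>\<open>G\<close> agrees with \<open>g\<close> on the projections by the germ
    identity; comparing the two equations on \<open>U\<close> then gives agreement of
    \<open>F\<close> with \<open>f\<close> on the sums.\<close>
  have ext: "extends_on U f g F G"
    using FG[of U] assms(6) g
    by (auto simp: extends_on_def pexider_on_def coord_sums_def coord_proj_def G_def)
  \<comment> \<open>A global solution is affine, and as an extension of \<open>g\<close> its data
    form an affine germ of \<open>g\<close> at \<open>p\<close>, which is unique.\<close>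
  have unique: "F' = F \<and> G' = G" if ext: "extends_on U f g F' G'" and pex: "pexider_on UNIV F' G'"
    for F' G'
  proof -
    obtain A' v' where A': "Modules.additive A'" "\<And>x. F' x = A' x + (\<Sum>i\<in>UNIV. v' i)"
      "\<And>i x. G' i x = A' x + v' i"
      using pexider_on_UNIV[OF assms(2) pex] by blast
    have "\<forall>\<^sub>F x in nhds p. x \<in> U" using assms(4) p by (rule eventually_nhds_in_open)
    then have "\<forall>\<^sub>F x in nhds p. \<forall>i. g i (x $ i) = A' (x $ i) + v' i"
    proof eventually_elim
      case (elim x)
      then have "G' i (x $ i) = g i (x $ i)" for i
        using ext by (auto simp: extends_on_def coord_proj_def)
      then show ?case by (simp add: A'(3)[symmetric])
    qed
    with A'(1) have "affine_germ g p A' v'" by (simp add: affine_germ_def)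
    with germ[OF p] have "A = A' \<and> v = v'" by (rule affine_germ_unique)
    then have "F' x = F x" "G' i x = G i x" for i x
      by (simp_all add: F_def G_def A'(2,3))
    then show ?thesis by (simp add: fun_eq_iff)
  qed
  have "\<exists>!(F, G). extends_on U f g F G \<and> pexider_on UNIV F G"
  proof (rule ex1I[of _ "(F, G)"])
    show "z = (F, G)" if "case z of (F, G) \<Rightarrow> extends_on U f g F G \<and> pexider_on UNIV F G" for z
      using that unique[of "fst z" "snd z"] by (simp add: case_prod_beta prod_eq_iff)
  qed (simp add: ext FG)
  moreover have "\<exists>!(A, u, v). Modules.additive A \<and> u = (\<Sum>i\<in>UNIV. v i) \<and>
      (\<forall>x. F x = A x + u) \<and> (\<forall>i x. G i x = A x + v i)"
    if pex: "pexider_on UNIV F G" for F :: "'x \<Rightarrow> 'y" and G :: "'n \<Rightarrow> 'x \<Rightarrow> 'y"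
  proof -
    obtain A v where A: "Modules.additive A" "\<And>x. F x = A x + (\<Sum>i\<in>UNIV. v i)"
      "\<And>i x. G i x = A x + v i"
      using pexider_on_UNIV[OF assms(2) pex] by blast
    have unique: "B = A \<and> w = v" if B: "Modules.additive B" "\<And>i x. G i x = B x + w i" for B w
    proof -
      \<comment> \<open>The constants are read off at 0, where additive maps vanish.\<close>
      have vw: "v i = w i" for i
        using A(3)[of i 0] B(2)[of i 0] by (simp add: Modules.additive.zero A(1) B(1))
      then have "A x = B x" for x
        using A(3)[of undefined x] B(2)[of undefined x] by simp
      with vw show ?thesis by auto
    qed
    show ?thesis
    proof (rule ex1I[of _ "(A, \<Sum>i\<in>UNIV. v i, v)"])
      show "z = (A, \<Sum>i\<in>UNIV. v i, v)"
        if "case z of (A, u, v) \<Rightarrow> Modules.additive A \<and> u = (\<Sum>i\<in>UNIV. v i) \<and>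
          (\<forall>x. F x = A x + u) \<and> (\<forall>i x. G i x = A x + v i)" for z
      proof (cases z)
        case (fields B u w)
        with that have B: "Modules.additive B" "u = (\<Sum>i\<in>UNIV. w i)" "\<And>i x. G i x = B x + w i"
          by simp_all
        from unique[OF B(1,3)] fields B(2) show ?thesis by simp
      qed
    next
      show "case (A, \<Sum>i\<in>UNIV. v i, v) of (A, u, v) \<Rightarrow> Modules.additive A \<and>
          u = (\<Sum>i\<in>UNIV. v i) \<and> (\<forall>x. F x = A x + u) \<and> (\<forall>i x. G i x = A x + v i)"
        unfolding prod.case using A by (intro conjI allI refl)
    qed
  qed
  ultimately show ?thesis by (intro conjI allI impI) simp_all
qed

end
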